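(* Let $A\in\mathbb{R}_+^{n\times n}$ with $\lambda(A)>0$. Then: (1) $\operatorname{L}(C(A))$ is the linear hull of the subeigencone $V^*(A)$. (2) For $x\in\mathbb{R}_+^n$, $x\in\operatorname{ri}(V^*(A))$ if and only if $x$ is positive and, for $X=\operatorname{diag}(x)$, the matrix $X^{-1}AX$ is strictly visualized. (3) $\operatorname{ri}(V^*(A))$ contains an eigenvector of $A$ (associated with $\lambda(A)$) if and only if $V^*(A)=V(A)$. (4) If $A$ is definite, then any positive linear combination $x$ of all columns of $A^*$, and, if in addition $A$ is irreducible, also any positive log-convex combination $x$ of all columns of $A^*$, belongs to $\operatorname{ri}(V^*(A))$, and $X^{-1}AX$ with $X=\operatorname{diag}(x)$ is strictly visualized.
   Context: $\mathbb{R}_+$ is the set of nonnegative reals, $n\ge 1$, $[n]=\{1,\dots,n\}$. Max algebra: $a\oplus b=\max(a,b)$, $\otimes$ is ordinary multiplication; for matrices and vectors $(A\oplus B)_{ij}=\max(a_{ij},b_{ij})$, $(A\otimes B)_{ij}=\max_k a_{ik}b_{kj}$; $A^k$ denotes the $k$-fold $\otimes$-power. For $A=(a_{ij})\in\mathbb{R}_+^{n\times n}$, the digraph $D_A$ has node set $[n]$ and all edges $(i,j)\in[n]\times[n]$ with weights $a_{ij}$. The weight of a path $(i_1,\dots,i_p)$ is $a_{i_1i_2}\cdots a_{i_{p-1}i_p}$ (equal to $1$ if $p=1$); a path is positive if its weight is positive. A cycle $(i_1,\dots,i_k,i_1)$, $k\ge1$, has geometric mean $(a_{i_1i_2}\cdots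 a_{i_ki_1})^{1/k}$. $\lambda(A)$ is the maximum of the geometric means over all cycles. $A$ is definite if $\lambda(A)=1$. $A$ is irreducible if for any nodes $i,j$ there is a positive path from $i$ to $j$ in $D_A$. A cycle is critical if its geometric mean equals $\lambda(A)$; $N_c(A)$ and $E_c(A)$ are the sets of nodes and edges that belong to critical cycles; $C(A)=(N_c(A),E_c(A))$ is the critical digraph. For definite $A$, the Kleene star is $A^*=I\oplus A\oplus A^2\oplus\cdots$ (which is finite). An eigenvector of $A$ associated with $\lambda(A)$ is a nonzero $x\in\mathbb{R}_+^n$ with $A\otimes x=\lambda(A)x$. The eigencone is $V(A)=\{x\in\mathbb{R}_+^n: A\otimes x=\lambda(A)x\}$ and the subeigencone is $V^*(A)=\{x\in\mathbb{R}_+^n: A\otimes x\le\lambda(A)x\}$ (both contain the zero vector). $V^*(A)$ is a convex cone. Define the linear subspace $$\operatorname{L}(C(A))=\{x\in\mathbb{R}^n: a_{ij}x_j=\lambda(A)x_i\ \ \forall (i,j)\in E_c(A)\}.$$ For a convex cone $K$, its linear hull $\operatorname{Lin}(K)$ is the least linear subspace containing $K$, and its relative interior $\operatorname{ri}(K)$ is the set of $y\in K$ such that $B_y^\varepsilon\cap\operatorname{Lin}(K)\subseteq K$ for all sufficiently small $\varepsilon>0$, where $B_y^\varepsilon$ is the open ball of radius $\varepsilon$ centered at $y$. $\operatorname{diag}(x)$ is the diagonal matrix with diagonal entries $x_1,\dots,x_n$; $x$ positive means all $x_i>0$. A matrix $B=(b_{ij})\in\mathbb{R}_+^{n\times n}$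 is strictly visualized if $b_{ij}=\lambda(B)$ for all $(i,j)\in E_c(B)$ and $b_{ij}<\lambda(B)$ for all $(i,j)\notin E_c(B)$. A positive linear combination of $y^1,\dots,y^m\in\mathbb{R}_+^n$ is $\sum_i\lambda_iy^i$ with all $\lambda_i>0$; a positive log-convex combination is $\prod_i (y^i)^{\lambda_i}$ with all $\lambda_i>0$ and $\sum_i\lambda_i=1$, powers and products taken componentwise. *)

theory Defs
  imports "HOL-Analysis.Analysis"
begin

section \<open>Max-algebraic products, powers and Kleene star\<close>

definition nonneg_mat :: "real ^ 'n ^ 'm \<Rightarrow> bool" where
  "nonneg_mat A \<longleftrightarrow> (\<forall>i j. 0 \<le> A $ i $ j)"

definition max_mult :: "real ^ 'n ^ 'm \<Rightarrow> real ^ 'k ^ 'n \<Rightarrow> real ^ 'k ^ 'm" where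
  "max_mult A B = (\<chi> i j. Max (range (\<lambda>k. A $ i $ k * B $ k $ j)))"

definition max_mult_vec :: "real ^ 'n ^ 'm \<Rightarrow> real ^ 'n \<Rightarrow> real ^ 'm" where
  "max_mult_vec A x = (\<chi> i. Max (range (\<lambda>j. A $ i $ j * x $ j)))"

primrec max_power :: "real ^ 'n ^ 'n \<Rightarrow> nat \<Rightarrow> real ^ 'n ^ 'n" where
  "max_power A 0 = mat 1"
| "max_power A (Suc k) = max_mult A (max_power A k)"

text \<open>The supremum is finite for definite matrices, the only case in which the star is used.\<close>

definition kleene_star :: "real ^ 'n ^ 'n \<Rightarrow> real ^ 'n ^ 'n" where
  "kleene_star A = (\<chi> i j. SUP k. max_power A k $ i $ j)"

section \<open>Paths and cycles\<close>

text \<open>A path is a nonempty list of nodes. A cycle is written as the list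
  \<open>[i\<^sub>1, \<dots>, i\<^sub>k, i\<^sub>1]\<close> with \<open>k \<ge> 1\<close>, so its list length is \<open>k + 1\<close>; its nodes need
  not be distinct.\<close>

fun path_weight :: "real ^ 'n ^ 'n \<Rightarrow> 'n list \<Rightarrow> real" where
  "path_weight A (i # j # p) = A $ i $ j * path_weight A (j # p)"
| "path_weight A p = 1"

definition path_edges :: "'n list \<Rightarrow> ('n \<times> 'n) set" where
  "path_edges p = set (zip p (tl p))"

definition is_cycle :: "'n list \<Rightarrow> bool" where
  "is_cycle c \<longleftrightarrow> 2 \<le> length c \<and> hd c = last c"

definition cycle_mean :: "real ^ 'n ^ 'n \<Rightarrow> 'n list \<Rightarrow> real" where
  "cycle_mean A c = root (length c - 1) (path_weight A c)"

definition max_cycle_mean :: "real ^ 'n ^ 'n \<Rightarrow> real" where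
  "max_cycle_mean A = Sup {cycle_mean A c | c. is_cycle c}"

definition definite_mat :: "real ^ 'n ^ 'n \<Rightarrow> bool" where
  "definite_mat A \<longleftrightarrow> max_cycle_mean A = 1"

definition irreducible_mat :: "real ^ 'n ^ 'n \<Rightarrow> bool" where
  "irreducible_mat A \<longleftrightarrow>
    (\<forall>i j. \<exists>p. p \<noteq> [] \<and> hd p = i \<and> last p = j \<and> 0 < path_weight A p)"

definition critical_cycle :: "real ^ 'n ^ 'n \<Rightarrow> 'n list \<Rightarrow> bool" where
  "critical_cycle A c \<longleftrightarrow> is_cycle c \<and> cycle_mean A c = max_cycle_mean A"

definition critical_edges :: "real ^ 'n ^ 'n \<Rightarrow> ('n \<times> 'n) set" where
  "critical_edges A = (\<Union>c \<in> {c. critical_cycle A c}. path_edges c)"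

section \<open>Eigencone, subeigencone and visualization\<close>

definition eigencone :: "real ^ 'n ^ 'n \<Rightarrow> (real ^ 'n) set" where
  "eigencone A = {x. 0 \<le> x \<and> max_mult_vec A x = max_cycle_mean A *\<^sub>R x}"

definition subeigencone :: "real ^ 'n ^ 'n \<Rightarrow> (real ^ 'n) set" where
  "subeigencone A = {x. 0 \<le> x \<and> max_mult_vec A x \<le> max_cycle_mean A *\<^sub>R x}"

definition eigenvector :: "real ^ 'n ^ 'n \<Rightarrow> real ^ 'n \<Rightarrow> bool" where
  "eigenvector A x \<longleftrightarrow> x \<noteq> 0 \<and> 0 \<le> x \<and> max_mult_vec A x = max_cycle_mean A *\<^sub>R x"

definition critical_subspace :: "real ^ 'n ^ 'n \<Rightarrow> (real ^ 'n) set" where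
  "critical_subspace A =
    {x. \<forall>(i, j) \<in> critical_edges A. A $ i $ j * x $ j = max_cycle_mean A * x $ i}"

definition positive_vec :: "real ^ 'n \<Rightarrow> bool" where
  "positive_vec x \<longleftrightarrow> (\<forall>i. 0 < x $ i)"

definition diag_mat :: "real ^ 'n \<Rightarrow> real ^ 'n ^ 'n" where
  "diag_mat x = (\<chi> i j. if i = j then x $ i else 0)"

definition diag_scaling :: "real ^ 'n \<Rightarrow> real ^ 'n ^ 'n \<Rightarrow> real ^ 'n ^ 'n" where
  "diag_scaling x A = matrix_inv (diag_mat x) ** A ** diag_mat x"

definition strictly_visualized :: "real ^ 'n ^ 'n \<Rightarrow> bool" where
  "strictly_visualized B \<longleftrightarrow> nonneg_mat B \<and>
    (\<forall>i j. if (i, j) \<in> critical_edges B then B $ i $ j = max_cycle_mean B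
           else B $ i $ j < max_cycle_mean B)"

section \<open>Positive combinations\<close>

definition positive_linear_comb :: "('m::finite \<Rightarrow> real ^ 'n) \<Rightarrow> real ^ 'n \<Rightarrow> bool" where
  "positive_linear_comb y x \<longleftrightarrow>
    (\<exists>c. (\<forall>k. 0 < c k) \<and> x = (\<Sum>k\<in>UNIV. c k *\<^sub>R y k))"

text \<open>For nonnegative \<open>y k\<close> and positive exponents, \<open>powr\<close> is the usual power,
  including \<open>0 powr a = 0\<close>.\<close>

definition positive_log_convex_comb :: "('m::finite \<Rightarrow> real ^ 'n) \<Rightarrow> real ^ 'n \<Rightarrow> bool" where
  "positive_log_convex_comb y x \<longleftrightarrow>
    (\<exists>c. (\<forall>k. 0 < c k) \<and> (\<Sum>k\<in>UNIV. c k) = 1 \<and>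
         x = (\<chi> i. \<Prod>k\<in>UNIV. (y k $ i) powr c k))"

section \<open>Adequacy of the definitions\<close>

text \<open>\<^const>\<open>rel_interior\<close> is defined through the affine hull; on sets containing \<open>0\<close>, such as
  the subeigencone, it is the relative interior with respect to the linear hull.\<close>

lemma rel_interior_span:
  fixes K :: "'a::euclidean_space set"
  assumes "0 \<in> K"
  shows "rel_interior K =
    {y \<in> K. \<exists>e0>0. \<forall>e. 0 < e \<and> e < e0 \<longrightarrow> ball y e \<inter> span K \<subseteq> K}"
proof -
  have "affine hull K = span K"
    using assms by (simp add: affine_hull_span_0 hull_inc)
  then have *: "rel_interior K = {y \<in> K. \<exists>e>0. ball y e \<inter> span K \<subseteq> K}"
    by (auto simp: rel_interior_ball)
  have "(\<exists>e>0. ball y e \<inter> span K \<subseteq> K) \<longleftrightarrow>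
        (\<exists>e0>0. \<forall>e. 0 < e \<and> e < e0 \<longrightarrow> ball y e \<inter> span K \<subseteq> K)" for y
  proof
    assume "\<exists>e>0. ball y e \<inter> span K \<subseteq> K"
    then obtain e0 where e0: "e0 > 0" "ball y e0 \<inter> span K \<subseteq> K" by blast
    have "ball y e \<inter> span K \<subseteq> K" if "e < e0" for e
      using e0(2) subset_ball[of e e0 y] that by auto
    with e0(1) show "\<exists>e0>0. \<forall>e. 0 < e \<and> e < e0 \<longrightarrow> ball y e \<inter> span K \<subseteq> K" by blast
  next
    assume "\<exists>e0>0. \<forall>e. 0 < e \<and> e < e0 \<longrightarrow> ball y e \<inter> span K \<subseteq> K"
    then show "\<exists>e>0. ball y e \<inter> span K \<subseteq> K" by (meson field_lbound_gt_zero)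
  qed
  with * show ?thesis by simp
qed

lemma zero_in_subeigencone:
  fixes A :: "real ^ 'n ^ 'n"
  shows "0 \<in> subeigencone A"
proof -
  show ?thesis
    by (simp add: subeigencone_def max_mult_vec_def less_eq_vec_def)
qed

lemma path_weight_nonneg: "nonneg_mat A \<Longrightarrow> 0 \<le> path_weight A p"
  by (induction A p rule: path_weight.induct) (auto simp: nonneg_mat_def)

lemma path_weight_append:
  "path_weight A (p @ i # q) = path_weight A (p @ [i]) * path_weight A (i # q)"
proof (induction p)
  case Nil
  show ?case by simp
next
  case (Cons a p)
  then show ?case by (cases p) auto
qed

text \<open>The supremum in \<^const>\<open>max_cycle_mean\<close> is attained, hence a maximum: repeatedly splitting
  off a closed subpath reduces to cycles with at most \<open>n\<close> edges, and there are finitely many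
  of these.\<close>

lemma max_cycle_mean_is_maximum:
  fixes A :: "real ^ 'n ^ 'n"
  assumes A: "nonneg_mat A"
  shows "\<exists>c. is_cycle c \<and> cycle_mean A c = max_cycle_mean A"
    and "is_cycle c \<Longrightarrow> cycle_mean A c \<le> max_cycle_mean A"
proof -
  define S :: "'n list set" where "S = {c. is_cycle c \<and> length c \<le> CARD('n) + 1}"
  have "finite {c :: 'n list. set c \<subseteq> UNIV \<and> length c \<le> CARD('n) + 1}"
    by (rule finite_lists_length_le) simp
  then have finS: "finite S" by (rule rev_finite_subset) (auto simp: S_def)
  have "[undefined, undefined] \<in> S"
    by (simp add: S_def is_cycle_def Suc_le_eq)
  then have neS: "S \<noteq> {}" by blast
  define M where "M = Max (cycle_mean A ` S)"
  have "M \<in> cycle_mean A ` S"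
    unfolding M_def using finS neS by (intro Max_in) auto
  then obtain c0 where c0: "c0 \<in> S" "cycle_mean A c0 = M" by blast
  have M0: "0 \<le> M"
    using c0(2) path_weight_nonneg[OF A] by (auto simp: cycle_mean_def real_root_ge_zero)
  have bound: "path_weight A c \<le> M ^ (length c - 1)" if "is_cycle c" for c
    using that
  proof (induction c rule: length_induct)
    case (1 c)
    show ?case
    proof (cases "length c \<le> CARD('n) + 1")
      case True
      with 1(2) have "c \<in> S" by (simp add: S_def)
      then have le: "cycle_mean A c \<le> M" unfolding M_def using finS by auto
      have "path_weight A c = cycle_mean A c ^ (length c - 1)"
        unfolding cycle_mean_def using 1(2) path_weight_nonneg[OF A]
        by (subst real_root_pow_pos2) (auto simp: is_cycle_def)
      also have "\<dots> \<le> M ^ (length c - 1)"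
        using le path_weight_nonneg[OF A]
        by (intro power_mono) (auto simp: cycle_mean_def real_root_ge_zero)
      finally show ?thesis .
    next
      case False
      then obtain a t where c: "c = a # t" by (cases c) auto
      have "\<not> distinct t"
      proof
        assume "distinct t"
        then have "length t = card (set t)" by (simp add: distinct_card)
        also have "\<dots> \<le> CARD('n)" by (rule card_mono) auto
        finally show False using False c by simp
      qed
      then obtain xs ys zs y where t: "t = xs @ [y] @ ys @ [y] @ zs"
        using not_distinct_decomp by blast
      let ?c1 = "y # ys @ [y]" and ?c2 = "a # xs @ y # zs"
      have cyc: "is_cycle ?c1" "is_cycle ?c2"
        using 1(2) by (auto simp: is_cycle_def c t split: if_splits)
      have len: "length ?c1 < length c" "length ?c2 < length c"
        using 1(2) by (auto simp: c t is_cycle_def)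
      have IH: "path_weight A ?c1 \<le> M ^ (length ?c1 - 1)" "path_weight A ?c2 \<le> M ^ (length ?c2 - 1)"
        using 1(1) cyc len by blast+
      have "path_weight A c = path_weight A ((a # xs) @ y # (ys @ y # zs))"
        by (simp add: c t)
      also have "\<dots> = path_weight A ((a # xs) @ [y]) * path_weight A ((y # ys) @ y # zs)"
        by (subst path_weight_append) simp
      also have "path_weight A ((y # ys) @ y # zs)
          = path_weight A ?c1 * path_weight A (y # zs)"
        by (subst path_weight_append) simp
      also have "path_weight A ((a # xs) @ [y]) * (path_weight A ?c1 * path_weight A (y # zs))
          = path_weight A ?c1 * path_weight A ?c2"
        using path_weight_append[of A "a # xs" y zs] by simp
      also have "\<dots> \<le> M ^ (length ?c1 - 1) * M ^ (length ?c2 - 1)"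
        by (intro mult_mono IH path_weight_nonneg[OF A] zero_le_power M0)
      also have "\<dots> = M ^ (length c - 1)"
        by (simp add: c t flip: power_add) (simp add: algebra_simps power_add)
      finally show ?thesis .
    qed
  qed
  have le: "cycle_mean A c \<le> M" if "is_cycle c" for c
  proof -
    have "cycle_mean A c \<le> root (length c - 1) (M ^ (length c - 1))"
      unfolding cycle_mean_def using bound[OF that] that
      by (intro real_root_le_mono) (auto simp: is_cycle_def)
    also have "\<dots> = M"
      using that M0 by (intro real_root_power_cancel) (auto simp: is_cycle_def)
    finally show ?thesis .
  qed
  have c0': "is_cycle c0" using c0(1) by (simp add: S_def)
  have eq: "max_cycle_mean A = M"
    unfolding max_cycle_mean_def
    by (rule cSup_eq_maximum) (use c0(2) c0' le in auto)
  show "\<exists>c. is_cycle c \<and> cycle_mean A c = max_cycle_mean A" using eq c0(2) c0' by auto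
  show "is_cycle c \<Longrightarrow> cycle_mean A c \<le> max_cycle_mean A" using eq le by simp
qed

end

theory Submission
  imports Defs
begin

text \<open>On a critical edge every subeigenvector attains equality, since going round the critical
  cycle turns the chain of subeigenvector inequalities into its own converse; hence the
  subeigencone lies in the critical subspace. Inside that subspace the positive vectors whose
  inequalities are strict on all noncritical edges form a relatively open set. It is nonempty,
  because it contains the sum of the columns of the Kleene star of \<open>A\<close> divided by its maximal
  cycle mean. Hence the subeigencone spans the critical subspace, and its relative interior is
  exactly this set, which diagonal scaling translates into strict visualization.\<close>

section \<open>Weights of paths and critical edges\<close>

text \<open>The shared node must be listed only once, hence \<open>tl q\<close>. This is what allows
  a cycle to be cut open and restarted elsewhere.\<close>

lemma path_weight_join:
  assumes "p \<noteq> []" "q \<noteq> []" "last p = hd q"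
  shows "path_weight A (p @ tl q) = path_weight A p * path_weight A q"
proof -
  obtain q' where q: "q = hd q # q'"
    using assms(2) by (cases q) auto
  have p: "p = butlast p @ [hd q]"
    using assms by (simp flip: assms(3))
  have "p @ tl q = butlast p @ hd q # q'"
    using p q by (metis append.assoc append_Cons append_Nil list.sel(3))
  then show ?thesis
    using path_weight_append[of A "butlast p" "hd q" q'] p q by simp
qed

text \<open>Replaces the \<open>zip\<close> encoding by a splitting of the list, at which a cycle
  through a given edge can be cut.\<close>

lemma path_edges_iff: "(i, j) \<in> path_edges c \<longleftrightarrow> (\<exists>us vs. c = us @ i # j # vs)"
proof (induction c)
  case Nil
  show ?case by (simp add: path_edges_def)
next
  case (Cons a c)
  show ?case
  proof (cases c)
    case Nil
    then show ?thesis by (auto simp: path_edges_def Cons_eq_append_conv)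
  next
    case (Cons b c')
    have "(i, j) \<in> path_edges (a # c) \<longleftrightarrow> i = a \<and> j = b \<or> (i, j) \<in> path_edges c"
      by (auto simp: path_edges_def Cons)
    then show ?thesis
      using Cons.IH Cons by (auto simp: Cons_eq_append_conv)
  qed
qed

lemma max_cycle_mean_nonneg:
  assumes "nonneg_mat A"
  shows "0 \<le> max_cycle_mean A"
proof -
  obtain c where "cycle_mean A c = max_cycle_mean A"
    using max_cycle_mean_is_maximum(1)[OF assms] by blast
  then show ?thesis
    using path_weight_nonneg[OF assms, of c] by (metis cycle_mean_def real_root_ge_zero)
qed

lemma path_weight_cycle_eq:
  assumes "nonneg_mat A" "is_cycle c"
  shows "path_weight A c = cycle_mean A c ^ (length c - 1)"
  using assms path_weight_nonneg[OF assms(1), of c]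
  by (auto simp: cycle_mean_def is_cycle_def real_root_pow_pos2)

lemma cycle_mean_nonneg:
  assumes "nonneg_mat A"
  shows "0 \<le> cycle_mean A c"
  using path_weight_nonneg[OF assms, of c] by (simp add: cycle_mean_def real_root_ge_zero)

lemma path_weight_cycle_le:
  assumes "nonneg_mat A" "is_cycle c"
  shows "path_weight A c \<le> max_cycle_mean A ^ (length c - 1)"
  using max_cycle_mean_is_maximum(2)[OF assms] cycle_mean_nonneg[OF assms(1)]
  by (simp add: path_weight_cycle_eq[OF assms] power_mono)

text \<open>Powers with positive exponent are injective on nonnegative reals, so the root in the
  cycle mean can be traded for a power. This suits products of weights better.\<close>

lemma critical_cycle_iff:
  assumes "nonneg_mat A" "is_cycle c"
  shows "critical_cycle A c \<longleftrightarrow> path_weight A c = max_cycle_mean A ^ (length c - 1)"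
proof -
  have "0 < length c - 1"
    using assms(2) by (auto simp: is_cycle_def)
  then show ?thesis
    using assms cycle_mean_nonneg[OF assms(1)] max_cycle_mean_nonneg[OF assms(1)]
    by (auto simp: critical_cycle_def path_weight_cycle_eq intro: power_eq_imp_eq_base)
qed

text \<open>Here \<open>p\<close> is a return path from \<open>j\<close> to \<open>i\<close>.
  Putting \<open>i\<close> in front closes it to a cycle with exactly \<open>length p\<close> edges,
  and \<open>w\<close> says that this cycle is critical.\<close>

lemma critical_edgeI:
  assumes A: "nonneg_mat A" and p: "p \<noteq> []" "hd p = j" "last p = i"
    and w: "A $ i $ j * path_weight A p = max_cycle_mean A ^ length p"
  shows "(i, j) \<in> critical_edges A"
proof -
  obtain p' where p': "p = j # p'"
    using p by (cases p) auto
  have "is_cycle (i # p)"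
    using p by (auto simp: is_cycle_def p')
  moreover have "path_weight A (i # p) = max_cycle_mean A ^ (length (i # p) - 1)"
    using w by (simp add: p')
  ultimately have "critical_cycle A (i # p)"
    using critical_cycle_iff[OF A] by blast
  moreover have "(i, j) \<in> path_edges (i # p)"
    by (simp add: path_edges_def p')
  ultimately show ?thesis
    by (auto simp: critical_edges_def)
qed

text \<open>The converse of \<open>critical_edgeI\<close>: a critical cycle through the edge is
  rotated so that the edge comes first, and the rest is the return path.\<close>

lemma critical_edgeE:
  assumes A: "nonneg_mat A" and "(i, j) \<in> critical_edges A"
  obtains p where "p \<noteq> []" "hd p = j" "last p = i"
    "A $ i $ j * path_weight A p = max_cycle_mean A ^ length p"
proof -
  obtain c where c: "critical_cycle A c" "(i, j) \<in> path_edges c"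
    using assms(2) by (auto simp: critical_edges_def)
  then obtain us vs where split: "c = us @ i # j # vs"
    by (auto simp: path_edges_iff)
  have cyc: "is_cycle c"
    using c by (simp add: critical_cycle_def)
  \<comment> \<open>The return path runs from \<open>j\<close> to the end of the cycle and then from
    its beginning up to \<open>i\<close>. The two meet in the base point of the cycle, whose second
    copy \<open>tl\<close> removes.\<close>
  let ?p = "(j # vs) @ tl (us @ [i])"
  have join: "last (j # vs) = hd (us @ [i])"
    using cyc by (cases us) (auto simp: is_cycle_def split)
  have w: "path_weight A c = path_weight A (us @ [i]) * (A $ i $ j * path_weight A (j # vs))"
    unfolding split by (subst path_weight_append) simp
  have "path_weight A ?p = path_weight A (j # vs) * path_weight A (us @ [i])"
    using join by (intro path_weight_join) auto
  then have "A $ i $ j * path_weight A ?p = path_weight A c"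
    by (simp add: w)
  also have "\<dots> = max_cycle_mean A ^ length ?p"
    using critical_cycle_iff[OF A cyc] c by (simp add: split add.commute)
  finally show ?thesis
    using that[of ?p] join by (cases us) auto
qed

section \<open>Invariance of critical edges under scaling\<close>

text \<open>A common positive factor on all cycle means scales their maximum and leaves the
  maximizing cycles unchanged. It serves both multiplication by a scalar and, with
  \<open>d = 1\<close>, diagonal similarity.\<close>

lemma cycle_mean_proportional:
  assumes A: "nonneg_mat A" and B: "nonneg_mat B" and d: "0 < d"
    and eq: "\<And>c. is_cycle c \<Longrightarrow> cycle_mean B c = d * cycle_mean A c"
  shows "max_cycle_mean B = d * max_cycle_mean A"
    and "critical_edges B = critical_edges A"
proof -
  obtain c where c: "is_cycle c" "cycle_mean A c = max_cycle_mean A"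
    using max_cycle_mean_is_maximum(1)[OF A] by blast
  obtain c' where c': "is_cycle c'" "cycle_mean B c' = max_cycle_mean B"
    using max_cycle_mean_is_maximum(1)[OF B] by blast
  have "max_cycle_mean B \<le> d * max_cycle_mean A"
    using eq[OF c'(1)] c' max_cycle_mean_is_maximum(2)[OF A c'(1)] d by simp
  moreover have "d * max_cycle_mean A \<le> max_cycle_mean B"
    using eq[OF c(1)] c max_cycle_mean_is_maximum(2)[OF B c(1)] by simp
  ultimately show max: "max_cycle_mean B = d * max_cycle_mean A"
    by simp
  have "critical_cycle B = critical_cycle A"
    using d by (auto simp: fun_eq_iff critical_cycle_def max eq)
  then show "critical_edges B = critical_edges A"
    by (simp add: critical_edges_def)
qed

lemma path_weight_scaleR: "path_weight (d *\<^sub>R A) p = d ^ (length p - 1) * path_weight A p"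
  by (induction A p rule: path_weight.induct) (auto simp: algebra_simps)

lemma
  assumes A: "nonneg_mat A" and d: "0 < d"
  shows max_cycle_mean_scaleR: "max_cycle_mean (d *\<^sub>R A) = d * max_cycle_mean A"
    and critical_edges_scaleR: "critical_edges (d *\<^sub>R A) = critical_edges A"
proof -
  have B: "nonneg_mat (d *\<^sub>R A)"
    using A d by (simp add: nonneg_mat_def)
  have eq: "cycle_mean (d *\<^sub>R A) c = d * cycle_mean A c" if "is_cycle c" for c
    using that d by (auto simp: cycle_mean_def path_weight_scaleR is_cycle_def real_root_mult
        real_root_power_cancel)
  show "max_cycle_mean (d *\<^sub>R A) = d * max_cycle_mean A"
    and "critical_edges (d *\<^sub>R A) = critical_edges A"
    using cycle_mean_proportional[OF A B d eq] by auto
qed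

section \<open>Diagonal similarity scaling\<close>

lemma diag_scaling_nth:
  assumes "positive_vec x"
  shows "diag_scaling x A $ i $ j = A $ i $ j * x $ j / x $ i"
proof -
  have nz: "x $ k \<noteq> 0" for k
    using assms by (metis positive_vec_def less_irrefl)
  let ?D = "\<chi> i j. if i = j then inverse (x $ i) else (0::real)"
  have 1: "?D ** diag_mat x = mat 1"
    by (auto simp: vec_eq_iff matrix_matrix_mult_def diag_mat_def mat_def nz
        if_distrib[of "\<lambda>y. y * _"] if_distrib[of "\<lambda>y. _ * y"] cong: if_cong)
  then have 2: "diag_mat x ** ?D = mat 1"
    by (simp add: matrix_left_right_inverse)
  have inv: "matrix_inv (diag_mat x) = ?D"
  proof -
    \<comment> \<open>\<open>matrix_inv\<close> is defined by choice, so the explicit two-sided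
      inverse \<open>?D\<close> is needed to show that the chosen matrix is an inverse at all.
      Associativity then identifies the two.\<close>
    have "matrix_inv (diag_mat x) ** diag_mat x = mat 1"
      using someI[of "\<lambda>E. diag_mat x ** E = mat 1 \<and> E ** diag_mat x = mat 1" ?D] 1 2
      by (simp add: matrix_inv_def)
    then show ?thesis
      using 2 matrix_mul_assoc[of "matrix_inv (diag_mat x)" "diag_mat x" ?D] by simp
  qed
  show ?thesis
    unfolding diag_scaling_def inv
    by (simp add: matrix_matrix_mult_def diag_mat_def
        if_distrib[of "\<lambda>y. y * _"] if_distrib[of "\<lambda>y. _ * y"] divide_simps nz cong: if_cong)
qed

text \<open>The factors \<open>x $ j / x $ i\<close> telescope along the path, so only its end
  points survive, and on a cycle these cancel too.\<close>

lemma path_weight_diag_scaling: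
  assumes "positive_vec x" "p \<noteq> []"
  shows "path_weight (diag_scaling x A) p = path_weight A p * x $ last p / x $ hd p"
proof -
  have nz: "x $ k \<noteq> 0" for k
    using assms by (metis positive_vec_def less_irrefl)
  show ?thesis
    using assms(2)
    by (induction A p rule: path_weight.induct)
      (auto simp: diag_scaling_nth[OF assms(1)] nz)
qed

lemma
  assumes A: "nonneg_mat A" and x: "positive_vec x"
  shows nonneg_mat_diag_scaling: "nonneg_mat (diag_scaling x A)"
    and max_cycle_mean_diag_scaling: "max_cycle_mean (diag_scaling x A) = max_cycle_mean A"
    and critical_edges_diag_scaling: "critical_edges (diag_scaling x A) = critical_edges A"
proof -
  show B: "nonneg_mat (diag_scaling x A)"
    using A x by (auto simp: nonneg_mat_def diag_scaling_nth positive_vec_def less_imp_le)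
  have eq: "cycle_mean (diag_scaling x A) c = 1 * cycle_mean A c" if "is_cycle c" for c
  proof -
    have "x $ last c \<noteq> 0"
      using x by (metis positive_vec_def less_irrefl)
    moreover have "c \<noteq> []" "hd c = last c"
      using that by (auto simp: is_cycle_def)
    ultimately show ?thesis
      by (simp add: cycle_mean_def path_weight_diag_scaling[OF x])
  qed
  show "max_cycle_mean (diag_scaling x A) = max_cycle_mean A"
    and "critical_edges (diag_scaling x A) = critical_edges A"
    using cycle_mean_proportional[OF A B zero_less_one eq] by auto
qed

section \<open>Subeigenvectors\<close>

lemma mem_subeigencone_iff:
  "x \<in> subeigencone A \<longleftrightarrow> 0 \<le> x \<and> (\<forall>i j. A $ i $ j * x $ j \<le> max_cycle_mean A * x $ i)"
  by (auto simp: subeigencone_def less_eq_vec_def max_mult_vec_def)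

text \<open>A maximum equals a given value iff the value is an upper bound and is attained. The
  attaining \<open>j\<close> singles out an edge leaving \<open>i\<close>, which is later shown to
  be critical.\<close>

lemma mem_eigencone_iff:
  "x \<in> eigencone A \<longleftrightarrow>
    x \<in> subeigencone A \<and> (\<forall>i. \<exists>j. A $ i $ j * x $ j = max_cycle_mean A * x $ i)"
proof -
  have "Max (range (\<lambda>j. A $ i $ j * x $ j)) = max_cycle_mean A * x $ i \<longleftrightarrow>
      (\<forall>j. A $ i $ j * x $ j \<le> max_cycle_mean A * x $ i) \<and>
      (\<exists>j. A $ i $ j * x $ j = max_cycle_mean A * x $ i)" for i
    by (subst Max_eq_iff) (auto simp: eq_commute)
  then show ?thesis
    by (auto simp: mem_subeigencone_iff eigencone_def max_mult_vec_def vec_eq_iff)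
qed

text \<open>The subeigenvector inequalities are chained along the path, each edge contributing one
  factor \<open>max_cycle_mean A\<close>.\<close>

lemma path_weight_subeigenvector_le:
  assumes A: "nonneg_mat A" and x: "x \<in> subeigencone A" and "p \<noteq> []"
  shows "path_weight A p * x $ last p \<le> max_cycle_mean A ^ (length p - 1) * x $ hd p"
  using \<open>p \<noteq> []\<close>
proof (induction p)
  case (Cons i q)
  show ?case
  proof (cases q)
    case (Cons j r)
    let ?m = "max_cycle_mean A"
    have "path_weight A (i # q) * x $ last (i # q) = A $ i $ j * (path_weight A q * x $ last q)"
      by (simp add: Cons)
    also have "\<dots> \<le> A $ i $ j * (?m ^ (length q - 1) * x $ j)"
      using Cons.IH A by (intro mult_left_mono) (auto simp: Cons nonneg_mat_def)
    also have "\<dots> = ?m ^ (length q - 1) * (A $ i $ j * x $ j)"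
      by simp
    also have "\<dots> \<le> ?m ^ (length q - 1) * (?m * x $ i)"
      using x max_cycle_mean_nonneg[OF A] by (intro mult_left_mono) (auto simp: mem_subeigencone_iff)
    finally show ?thesis
      by (simp add: Cons mult_ac)
  qed simp
qed simp

text \<open>Returning from \<open>j\<close> to \<open>i\<close> along the critical cycle bounds \<open>x $ j\<close> from below.\<close>

lemma subeigencone_subset_critical_subspace:
  assumes A: "nonneg_mat A" and m: "0 < max_cycle_mean A"
  shows "subeigencone A \<subseteq> critical_subspace A"
proof
  fix x assume x: "x \<in> subeigencone A"
  let ?m = "max_cycle_mean A"
  have "A $ i $ j * x $ j = ?m * x $ i" if ij: "(i, j) \<in> critical_edges A" for i j
  proof (rule antisym)
    show "A $ i $ j * x $ j \<le> ?m * x $ i"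
      using x by (simp add: mem_subeigencone_iff)
    obtain p where p: "p \<noteq> []" "hd p = j" "last p = i"
      and w: "A $ i $ j * path_weight A p = ?m ^ length p"
      using critical_edgeE[OF A ij] by blast
    obtain k where k: "length p = Suc k"
      using p(1) by (cases p) auto
    have "?m ^ k * (?m * x $ i) = A $ i $ j * (path_weight A p * x $ i)"
      using arg_cong[OF w[symmetric], of "\<lambda>t. t * x $ i"] by (simp add: k mult_ac)
    also have "\<dots> \<le> A $ i $ j * (?m ^ k * x $ j)"
      using path_weight_subeigenvector_le[OF A x p(1)] A p k
      by (intro mult_left_mono) (auto simp: nonneg_mat_def)
    finally have "?m ^ k * (?m * x $ i) \<le> ?m ^ k * (A $ i $ j * x $ j)"
      by (simp add: mult_ac)
    then show "?m * x $ i \<le> A $ i $ j * x $ j"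
      using m by simp
  qed
  then show "x \<in> critical_subspace A"
    by (auto simp: critical_subspace_def)
qed

lemma subspace_critical_subspace: "subspace (critical_subspace A)"
  unfolding critical_subspace_def
  by (rule subspaceI) (auto simp: algebra_simps case_prod_unfold)

section \<open>Strict subeigenvectors and the relative interior\<close>

text \<open>The intended description of the relative interior. Equality on critical edges is not
  demanded, since for a positive maximal cycle mean
  \<open>subeigencone_subset_critical_subspace\<close> yields it.\<close>

definition strict_subeigenvector :: "real ^ 'n ^ 'n \<Rightarrow> real ^ 'n \<Rightarrow> bool" where
  "strict_subeigenvector A x \<longleftrightarrow> x \<in> subeigencone A \<and> positive_vec x \<and>
    (\<forall>i j. (i, j) \<notin> critical_edges A \<longrightarrow> A $ i $ j * x $ j < max_cycle_mean A * x $ i)"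

text \<open>Dividing the inequality for \<open>(i, j)\<close> by \<open>x $ i\<close> compares an
  entry of the scaled matrix with the maximal cycle mean. The scaling changes neither that mean nor
  the critical edges.\<close>

lemma strict_subeigenvector_iff_strictly_visualized:
  assumes A: "nonneg_mat A" and m: "0 < max_cycle_mean A"
  shows "strict_subeigenvector A x \<longleftrightarrow> positive_vec x \<and> strictly_visualized (diag_scaling x A)"
proof (cases "positive_vec x")
  case True
  note scaling = max_cycle_mean_diag_scaling[OF A True] critical_edges_diag_scaling[OF A True]
    diag_scaling_nth[OF True]
  have pos: "0 < x $ k" for k
    using True by (simp add: positive_vec_def)
  then have nn: "0 \<le> x"
    by (simp add: less_eq_vec_def less_imp_le)
  have eq: "A $ i $ j * x $ j / x $ i = max_cycle_mean A \<longleftrightarrow>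
      A $ i $ j * x $ j = max_cycle_mean A * x $ i"
    and less: "A $ i $ j * x $ j / x $ i < max_cycle_mean A \<longleftrightarrow>
      A $ i $ j * x $ j < max_cycle_mean A * x $ i" for i j
    using pos[of i] by (auto simp: field_simps)
  have vis: "strictly_visualized (diag_scaling x A) \<longleftrightarrow>
      (\<forall>i j. if (i, j) \<in> critical_edges A then A $ i $ j * x $ j = max_cycle_mean A * x $ i
        else A $ i $ j * x $ j < max_cycle_mean A * x $ i)"
    unfolding strictly_visualized_def scaling eq less
    using nonneg_mat_diag_scaling[OF A True] by simp
  show ?thesis
  proof
    assume "strict_subeigenvector A x"
    then show "positive_vec x \<and> strictly_visualized (diag_scaling x A)"
      using subeigencone_subset_critical_subspace[OF A m]
      by (auto simp: strict_subeigenvector_def vis critical_subspace_def)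
  next
    assume "positive_vec x \<and> strictly_visualized (diag_scaling x A)"
    then have crit: "(i, j) \<in> critical_edges A \<Longrightarrow> A $ i $ j * x $ j = max_cycle_mean A * x $ i"
      and noncrit: "(i, j) \<notin> critical_edges A \<Longrightarrow> A $ i $ j * x $ j < max_cycle_mean A * x $ i"
      for i j
      by (auto simp: vis)
    then have "A $ i $ j * x $ j \<le> max_cycle_mean A * x $ i" for i j
      by (cases "(i, j) \<in> critical_edges A") (auto intro: less_imp_le)
    then show "strict_subeigenvector A x"
      using nn True noncrit by (simp add: strict_subeigenvector_def mem_subeigencone_iff)
  qed
qed (simp add: strict_subeigenvector_def)

lemma strict_subeigenvector_ball:
  assumes z: "strict_subeigenvector A z"
  obtains e where "0 < e" "ball z e \<inter> critical_subspace A \<subseteq> subeigencone A"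
proof -
  \<comment> \<open>\<open>U\<close> collects only the strict conditions, finitely many, and is
    therefore open. The equalities on critical edges come from intersecting with
    \<open>critical_subspace A\<close>.\<close>
  define U where "U = (\<Inter>i. {x. 0 < x $ i}) \<inter>
    (\<Inter>i. \<Inter>j\<in>{j. (i, j) \<notin> critical_edges A}. {x. A $ i $ j * x $ j < max_cycle_mean A * x $ i})"
  have "open U"
    unfolding U_def
    by (intro open_Int open_INT ballI open_Collect_less continuous_intros) auto
  moreover have "z \<in> U"
    using z by (auto simp: U_def strict_subeigenvector_def positive_vec_def)
  ultimately obtain e where e: "0 < e" "ball z e \<subseteq> U"
    by (meson openE)
  have "x \<in> subeigencone A" if x: "x \<in> U" "x \<in> critical_subspace A" for x
    unfolding mem_subeigencone_iff
  proof (intro conjI allI)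
    show "0 \<le> x"
      using x(1) by (auto simp: U_def less_eq_vec_def less_imp_le)
    fix i j
    show "A $ i $ j * x $ j \<le> max_cycle_mean A * x $ i"
      using x by (cases "(i, j) \<in> critical_edges A")
        (auto simp: U_def critical_subspace_def intro: less_imp_le)
  qed
  with e show ?thesis
    using that by blast
qed

text \<open>Near \<open>z\<close> the critical subspace lies inside the cone, so each of its vectors
  is a multiple of a difference of two cone points, \<open>z + t *\<^sub>R y\<close> and
  \<open>z\<close>.\<close>

lemma span_subeigencone:
  assumes A: "nonneg_mat A" and m: "0 < max_cycle_mean A" and z: "strict_subeigenvector A z"
  shows "span (subeigencone A) = critical_subspace A"
proof
  have sub: "subeigencone A \<subseteq> critical_subspace A"
    using subeigencone_subset_critical_subspace[OF A m] .
  then show "span (subeigencone A) \<subseteq> critical_subspace A"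
    by (simp add: span_minimal subspace_critical_subspace)
  obtain e where e: "0 < e" "ball z e \<inter> critical_subspace A \<subseteq> subeigencone A"
    using strict_subeigenvector_ball[OF z] .
  have zV: "z \<in> subeigencone A"
    using z by (simp add: strict_subeigenvector_def)
  show "critical_subspace A \<subseteq> span (subeigencone A)"
  proof
    fix y assume y: "y \<in> critical_subspace A"
    \<comment> \<open>Small enough for a step of length less than \<open>e\<close>. The summand 1
      keeps the denominator positive when \<open>y = 0\<close>.\<close>
    define t where "t = e / (2 * (norm y + 1))"
    have t: "0 < t"
      using e by (simp add: t_def add_nonneg_pos)
    have "t * norm y < t * (2 * (norm y + 1))"
      using t norm_ge_zero[of y] by (simp add: distrib_left add_nonneg_pos)
    also have "t * (2 * (norm y + 1)) = e"
      using add_nonneg_pos[OF norm_ge_zero[of y] zero_less_one] by (simp add: t_def)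
    finally have "z + t *\<^sub>R y \<in> ball z e"
      using t by (simp add: dist_norm)
    moreover have "z + t *\<^sub>R y \<in> critical_subspace A"
      using y zV sub subspace_critical_subspace[of A] by (auto intro!: subspace_add subspace_scale)
    ultimately have "z + t *\<^sub>R y \<in> subeigencone A"
      using e by auto
    then have "(1 / t) *\<^sub>R ((z + t *\<^sub>R y) - z) \<in> span (subeigencone A)"
      using zV by (intro span_scale span_diff span_base)
    then show "y \<in> span (subeigencone A)"
      using t by simp
  qed
qed

text \<open>From right to left this is the ball around a strict subeigenvector. Conversely, the
  segment from \<open>z\<close> to an interior point \<open>x\<close> can be prolonged slightly
  beyond \<open>x\<close> within the cone, so \<open>x\<close> is a combination of a cone point and
  \<open>z\<close> with positive coefficients and inherits strictness from \<open>z\<close>.\<close>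

lemma rel_interior_subeigencone:
  assumes A: "nonneg_mat A" and m: "0 < max_cycle_mean A" and z: "strict_subeigenvector A z"
  shows "x \<in> rel_interior (subeigencone A) \<longleftrightarrow> strict_subeigenvector A x"
proof -
  let ?V = "subeigencone A" and ?m = "max_cycle_mean A"
  have hull: "affine hull ?V = critical_subspace A"
    using span_subeigencone[OF A m z] zero_in_subeigencone[of A]
    by (simp add: affine_hull_span_0 hull_inc)
  show ?thesis
  proof
    assume x: "strict_subeigenvector A x"
    then obtain e where "0 < e" "ball x e \<inter> critical_subspace A \<subseteq> ?V"
      by (rule strict_subeigenvector_ball)
    with x show "x \<in> rel_interior ?V"
      by (auto simp: rel_interior_ball hull strict_subeigenvector_def)
  next
    assume "x \<in> rel_interior ?V"
    then obtain e where x: "x \<in> ?V" and e: "0 < e" "ball x e \<inter> critical_subspace A \<subseteq> ?V"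
      by (auto simp: rel_interior_ball hull)
    define t where "t = e / (2 * (norm (x - z) + 1))"
    have t: "0 < t"
      using e by (simp add: t_def add_nonneg_pos)
    have "t * norm (x - z) < t * (2 * (norm (x - z) + 1))"
      using t norm_ge_zero[of "x - z"] by (simp add: distrib_left add_nonneg_pos)
    also have "t * (2 * (norm (x - z) + 1)) = e"
      using add_nonneg_pos[OF norm_ge_zero[of "x - z"] zero_less_one] by (simp add: t_def)
    finally have "x + t *\<^sub>R (x - z) \<in> ball x e"
      using t by (simp add: dist_norm)
    moreover have "x + t *\<^sub>R (x - z) \<in> critical_subspace A"
      using x z subeigencone_subset_critical_subspace[OF A m] subspace_critical_subspace[of A]
      by (auto simp: strict_subeigenvector_def intro!: subspace_add subspace_scale subspace_diff)
    ultimately have y: "x + t *\<^sub>R (x - z) \<in> ?V" (is "?y \<in> _")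
      using e by auto
    \<comment> \<open>The definition of \<open>?y\<close> solved for \<open>x\<close>, with
      denominators cleared.\<close>
    have comb: "(1 + t) * x $ i = ?y $ i + t * z $ i" for i
      by (simp add: algebra_simps)
    have "positive_vec x"
      unfolding positive_vec_def
    proof
      fix i
      have "0 \<le> ?y $ i" "0 < t * z $ i"
        using y z t by (auto simp: mem_subeigencone_iff strict_subeigenvector_def positive_vec_def
            less_eq_vec_def)
      then have "0 < (1 + t) * x $ i"
        unfolding comb by linarith
      then show "0 < x $ i"
        using t by (simp add: zero_less_mult_iff)
    qed
    moreover have "A $ i $ j * x $ j < ?m * x $ i" if "(i, j) \<notin> critical_edges A" for i j
    proof -
      have "(1 + t) * (A $ i $ j * x $ j) = A $ i $ j * ((1 + t) * x $ j)"
        by simp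
      also have "\<dots> = A $ i $ j * ?y $ j + t * (A $ i $ j * z $ j)"
        unfolding comb by (simp add: algebra_simps)
      also have "\<dots> < ?m * ?y $ i + t * (?m * z $ i)"
        using y z t that
        by (intro add_le_less_mono mult_strict_left_mono)
          (auto simp: mem_subeigencone_iff strict_subeigenvector_def simp del: vector_add_component)
      also have "\<dots> = ?m * ((1 + t) * x $ i)"
        unfolding comb by (simp add: algebra_simps)
      also have "\<dots> = (1 + t) * (?m * x $ i)"
        by simp
      finally show ?thesis
        using t by simp
    qed
    ultimately show "strict_subeigenvector A x"
      using x by (simp add: strict_subeigenvector_def)
  qed
qed

text \<open>For a strict subeigenvector that is an eigenvector, each row maximum is attained on a
  critical edge. So every node has an outgoing critical edge, and there every subeigenvector attains
  equality. In the other direction \<open>z\<close> itself is the eigenvector.\<close>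

lemma eigencone_eq_subeigencone_iff:
  assumes A: "nonneg_mat A" and m: "0 < max_cycle_mean A" and z: "strict_subeigenvector A z"
  shows "(\<exists>x \<in> rel_interior (subeigencone A). eigenvector A x) \<longleftrightarrow> subeigencone A = eigencone A"
proof
  assume "\<exists>x \<in> rel_interior (subeigencone A). eigenvector A x"
  then obtain x where x: "strict_subeigenvector A x" "x \<in> eigencone A"
    by (auto simp: rel_interior_subeigencone[OF A m z] eigenvector_def eigencone_def)
  have "y \<in> eigencone A" if y: "y \<in> subeigencone A" for y
    unfolding mem_eigencone_iff
  proof (intro conjI allI y)
    fix i
    obtain j where "A $ i $ j * x $ j = max_cycle_mean A * x $ i"
      using x(2) by (auto simp: mem_eigencone_iff)
    then have "(i, j) \<in> critical_edges A"
      using x(1) unfolding strict_subeigenvector_def by force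
    then have "A $ i $ j * y $ j = max_cycle_mean A * y $ i"
      using y subeigencone_subset_critical_subspace[OF A m] by (auto simp: critical_subspace_def)
    then show "\<exists>j. A $ i $ j * y $ j = max_cycle_mean A * y $ i" ..
  qed
  then show "subeigencone A = eigencone A"
    by (auto simp: mem_eigencone_iff)
next
  assume eq: "subeigencone A = eigencone A"
  have "z \<in> subeigencone A"
    using z by (simp add: strict_subeigenvector_def)
  moreover have "z \<noteq> 0"
    using z by (auto simp: strict_subeigenvector_def positive_vec_def)
  ultimately have "eigenvector A z"
    unfolding eq by (simp add: eigenvector_def eigencone_def)
  then show "\<exists>x \<in> rel_interior (subeigencone A). eigenvector A x"
    using z rel_interior_subeigencone[OF A m z] by blast
qed

section \<open>The Kleene star of a definite matrix\<close>

lemma max_power_Suc_ge: "A $ i $ j * max_power A k $ j $ l \<le> max_power A (Suc k) $ i $ l"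
  by (simp add: max_mult_def)

lemma max_power_nonneg:
  assumes "nonneg_mat A"
  shows "0 \<le> max_power A k $ i $ j"
proof (induction k arbitrary: i)
  case 0
  show ?case by (simp add: mat_def)
next
  case (Suc k)
  have "0 \<le> A $ i $ i * max_power A k $ i $ j"
    using assms Suc by (simp add: nonneg_mat_def)
  then show ?case
    using max_power_Suc_ge order_trans by blast
qed

text \<open>A list of \<open>k + 1\<close> nodes has \<open>k\<close> edges, hence the exponent
  \<open>length p - 1\<close>. Together with \<open>max_power_attained\<close> this identifies
  positive entries of powers as largest path weights.\<close>

lemma path_weight_le_max_power:
  assumes A: "nonneg_mat A" and "p \<noteq> []"
  shows "path_weight A p \<le> max_power A (length p - 1) $ hd p $ last p"
  using \<open>p \<noteq> []\<close>
proof (induction p)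
  case (Cons i q)
  show ?case
  proof (cases q)
    case Nil
    then show ?thesis by (simp add: mat_def)
  next
    case (Cons j r)
    have "path_weight A (i # q) \<le> A $ i $ j * max_power A (length q - 1) $ j $ last q"
      using Cons.IH A by (simp add: Cons nonneg_mat_def mult_left_mono del: max_power.simps)
    also have "\<dots> \<le> max_power A (Suc (length q - 1)) $ i $ last q"
      by (rule max_power_Suc_ge)
    finally show ?thesis
      by (simp add: Cons)
  qed
qed simp

text \<open>Choosing a maximizer in each product builds the path edge by edge. Positivity excludes
  the off-diagonal zeros of \<open>mat 1\<close>, which are not weights of any path.\<close>

lemma max_power_attained:
  assumes A: "nonneg_mat A" and "0 < max_power A k $ i $ j"
  shows "\<exists>p. length p = Suc k \<and> hd p = i \<and> last p = j \<and> path_weight A p = max_power A k $ i $ j"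
  using assms(2)
proof (induction k arbitrary: i)
  case 0
  then show ?case
    by (intro exI[of _ "[i]"]) (auto simp: mat_def split: if_splits)
next
  case (Suc k)
  have "max_power A (Suc k) $ i $ j \<in> range (\<lambda>l. A $ i $ l * max_power A k $ l $ j)"
    by (simp add: max_mult_def del: Max_in) (intro Max_in, auto)
  then obtain l where l: "max_power A (Suc k) $ i $ j = A $ i $ l * max_power A k $ l $ j"
    by auto
  have "0 < max_power A k $ l $ j"
    using Suc.prems l max_power_nonneg[OF A, of k l j] by (cases "max_power A k $ l $ j = 0") auto
  then obtain p where "length p = Suc k" "hd p = l" "last p = j"
      "path_weight A p = max_power A k $ l $ j"
    using Suc.IH by blast
  moreover from this obtain q where "p = l # q"
    by (cases p) auto
  ultimately show ?case
    using l by (intro exI[of _ "i # p"]) auto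
qed

section \<open>Finiteness of the Kleene star\<close>

text \<open>A repeated node encloses a cycle, whose weight is at most 1, so cutting it out does not
  decrease the weight. Once all nodes are distinct, there are at most \<open>CARD('n)\<close> of
  them.\<close>

lemma path_shorten:
  fixes A :: "real ^ 'n ^ 'n"
  assumes A: "nonneg_mat A" and le: "max_cycle_mean A \<le> 1" and "p \<noteq> []"
  shows "\<exists>q. q \<noteq> [] \<and> hd q = hd p \<and> last q = last p \<and> length q \<le> CARD('n) \<and>
    path_weight A p \<le> path_weight A q"
  using \<open>p \<noteq> []\<close>
proof (induction p rule: length_induct)
  case (1 p)
  show ?case
  proof (cases "distinct p")
    case True
    then have "length p \<le> CARD('n)"
      by (metis card_mono distinct_card finite subset_UNIV)
    then show ?thesis
      using 1 by blast
  next
    case False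
    then obtain xs ys zs y where p: "p = xs @ [y] @ ys @ [y] @ zs"
      using not_distinct_decomp by blast
    let ?c = "y # ys @ [y]" and ?q = "xs @ y # zs"
    have "is_cycle ?c"
      by (simp add: is_cycle_def)
    then have "path_weight A ?c \<le> max_cycle_mean A ^ (length ?c - 1)"
      by (rule path_weight_cycle_le[OF A])
    also have "\<dots> \<le> 1"
      by (intro power_le_one le max_cycle_mean_nonneg[OF A])
    finally have c: "path_weight A ?c \<le> 1" .
    have "path_weight A p = path_weight A (xs @ [y]) * (path_weight A ?c * path_weight A (y # zs))"
      using path_weight_append[of A xs y "ys @ y # zs"] path_weight_append[of A "y # ys" y zs]
      by (simp add: p)
    also have "\<dots> = path_weight A ?c * path_weight A ?q"
      using path_weight_append[of A xs y zs] by simp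
    also have "\<dots> \<le> path_weight A ?q"
      using c path_weight_nonneg[OF A, of ?q] path_weight_nonneg[OF A, of ?c]
      by (simp add: mult_left_le_one_le)
    finally have w: "path_weight A p \<le> path_weight A ?q" .
    have "hd ?q = hd p" "last ?q = last p" "length ?q < length p" "?q \<noteq> []"
      by (auto simp: p hd_append)
    then show ?thesis
      using 1(1)[rule_format, of ?q] w order_trans by metis
  qed
qed

lemma
  fixes A :: "real ^ 'n ^ 'n"
  assumes A: "nonneg_mat A" and le: "max_cycle_mean A \<le> 1"
  shows kleene_star_attained: "\<exists>k. kleene_star A $ i $ j = max_power A k $ i $ j"
    and max_power_le_kleene_star: "max_power A k $ i $ j \<le> kleene_star A $ i $ j"
proof -
  let ?f = "\<lambda>k. max_power A k $ i $ j"
  have fin: "finite (?f ` {..CARD('n)})" "?f ` {..CARD('n)} \<noteq> {}"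
    by auto
  \<comment> \<open>The best exponent up to \<open>CARD('n)\<close> is best overall: an optimal path
    for any other exponent shortens to one within this range.\<close>
  obtain m where m: "Max (?f ` {..CARD('n)}) = ?f m"
    using Max_in[OF fin] by blast
  have small: "?f k \<le> ?f m" if "k \<le> CARD('n)" for k
    using that fin unfolding m[symmetric] by (intro Max_ge) auto
  have bound: "?f k \<le> ?f m" for k
  proof (cases "0 < ?f k")
    case False
    then show ?thesis
      using max_power_nonneg[OF A, of m i j] by linarith
  next
    case True
    then obtain p where p: "length p = Suc k" "hd p = i" "last p = j" "path_weight A p = ?f k"
      using max_power_attained[OF A] by blast
    then have "p \<noteq> []"
      by auto
    then obtain q where q: "q \<noteq> []" "hd q = i" "last q = j" "length q \<le> CARD('n)"
        "path_weight A p \<le> path_weight A q"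
      using path_shorten[OF A le] p by blast
    then have "path_weight A q \<le> ?f (length q - 1)"
      using path_weight_le_max_power[OF A] by blast
    moreover have "?f (length q - 1) \<le> ?f m"
      using q by (intro small) simp
    ultimately show ?thesis
      using q p by linarith
  qed
  have eq: "kleene_star A $ i $ j = ?f m"
    unfolding kleene_star_def using bound by (auto intro!: cSup_eq_maximum)
  then show "\<exists>k. kleene_star A $ i $ j = ?f k" "?f k \<le> kleene_star A $ i $ j"
    using bound by auto
qed

lemma kleene_star_nonneg:
  assumes "nonneg_mat A" "max_cycle_mean A \<le> 1"
  shows "0 \<le> kleene_star A $ i $ j"
  using max_power_le_kleene_star[OF assms] max_power_nonneg[OF assms(1)] order_trans by blast

lemma kleene_star_diagonal_ge:
  assumes "nonneg_mat A" "max_cycle_mean A \<le> 1"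
  shows "1 \<le> kleene_star A $ i $ i"
  using max_power_le_kleene_star[OF assms, of 0 i i] by (simp add: mat_def)

lemma kleene_star_pos:
  assumes "nonneg_mat A" "max_cycle_mean A \<le> 1" "irreducible_mat A"
  shows "0 < kleene_star A $ i $ j"
proof -
  obtain p where "p \<noteq> []" "hd p = i" "last p = j" "0 < path_weight A p"
    using assms(3) unfolding irreducible_mat_def by blast
  then show ?thesis
    using path_weight_le_max_power[OF assms(1), of p]
      max_power_le_kleene_star[OF assms(1,2), of "length p - 1" i j] by simp
qed

text \<open>The edge is prefixed to a power attaining the star entry, which raises the exponent by
  one. For definite \<open>A\<close> this makes every column of the star a subeigenvector.\<close>

lemma mult_kleene_star_le:
  assumes "nonneg_mat A" "max_cycle_mean A \<le> 1"
  shows "A $ i $ j * kleene_star A $ j $ l \<le> kleene_star A $ i $ l"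
proof -
  obtain k where "kleene_star A $ j $ l = max_power A k $ j $ l"
    using kleene_star_attained[OF assms] by blast
  then have "A $ i $ j * kleene_star A $ j $ l \<le> max_power A (Suc k) $ i $ l"
    using max_power_Suc_ge by metis
  then show ?thesis
    using max_power_le_kleene_star[OF assms] order_trans by blast
qed

text \<open>If the star entry is positive, the product is the weight of a cycle through
  \<open>(i, j)\<close>, hence at most 1, and equality would make that edge critical.\<close>

lemma mult_kleene_star_less:
  assumes A: "nonneg_mat A" and m: "max_cycle_mean A = 1" and ij: "(i, j) \<notin> critical_edges A"
  shows "A $ i $ j * kleene_star A $ j $ i < 1"
proof (cases "0 < kleene_star A $ j $ i")
  case True
  obtain k where "kleene_star A $ j $ i = max_power A k $ j $ i"
    using kleene_star_attained[OF A] m by fastforce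
  then obtain p where p: "length p = Suc k" "hd p = j" "last p = i"
      "path_weight A p = kleene_star A $ j $ i"
    using max_power_attained[OF A] True by metis
  then obtain q where q: "p = j # q"
    by (cases p) auto
  have "is_cycle (i # p)"
    using p q by (auto simp: is_cycle_def)
  then have "A $ i $ j * kleene_star A $ j $ i \<le> 1"
    using path_weight_cycle_le[OF A, of "i # p"] p q m by simp
  moreover have "A $ i $ j * kleene_star A $ j $ i \<noteq> 1"
    using critical_edgeI[OF A _ p(2,3)] ij p q m by auto
  ultimately show ?thesis
    by simp
next
  case False
  then have "kleene_star A $ j $ i = 0"
    using kleene_star_nonneg[OF A, of j i] m by simp
  then show ?thesis
    by simp
qed

text \<open>In both kinds of combination the inequality at a noncritical \<open>(i, j)\<close> is strict thanks to
  column \<open>i\<close>: there it reads \<open>A $ i $ j * kleene_star A $ j $ i < kleene_star A $ i $ i\<close>.\<close>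

lemma positive_linear_comb_strict_subeigenvector:
  fixes A :: "real ^ 'n ^ 'n"
  assumes A: "nonneg_mat A" and m: "max_cycle_mean A = 1"
    and x: "positive_linear_comb (\<lambda>j. column j (kleene_star A)) x"
  shows "strict_subeigenvector A x"
proof -
  let ?S = "kleene_star A"
  have le1: "max_cycle_mean A \<le> 1"
    using m by simp
  note star = kleene_star_nonneg[OF A le1] kleene_star_diagonal_ge[OF A le1]
    mult_kleene_star_le[OF A le1]
  obtain c where c: "\<And>k. 0 < c k" and xc: "x = (\<Sum>k\<in>UNIV. c k *\<^sub>R column k ?S)"
    using x by (auto simp: positive_linear_comb_def)
  have xi: "x $ i = (\<Sum>k\<in>UNIV. c k * ?S $ i $ k)" for i
    by (simp add: xc column_def)
  have Ax: "A $ i $ j * x $ j = (\<Sum>k\<in>UNIV. c k * (A $ i $ j * ?S $ j $ k))" for i j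
    by (simp add: xi sum_distrib_left mult_ac)
  \<comment> \<open>The summand of column \<open>i\<close> is positive because the diagonal of the
    star is at least 1.\<close>
  have pos: "0 < x $ i" for i
    unfolding xi using c star order_less_le_trans[OF zero_less_one star(2)]
    by (intro sum_pos2[of _ i]) (auto simp: less_imp_le)
  have "A $ i $ j * x $ j \<le> x $ i" for i j
    unfolding Ax xi[of i] using c star by (intro sum_mono mult_left_mono) (auto simp: less_imp_le)
  moreover have "A $ i $ j * x $ j < x $ i" if "(i, j) \<notin> critical_edges A" for i j
    unfolding Ax xi[of i]
  proof (rule sum_strict_mono_ex1)
    show "\<forall>k\<in>UNIV. c k * (A $ i $ j * ?S $ j $ k) \<le> c k * ?S $ i $ k"
      using c star by (auto intro!: mult_left_mono simp: less_imp_le)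
    have "A $ i $ j * ?S $ j $ i < ?S $ i $ i"
      using mult_kleene_star_less[OF A m that] star(2)[of i] by linarith
    then show "\<exists>k\<in>UNIV. c k * (A $ i $ j * ?S $ j $ k) < c k * ?S $ i $ k"
      using c by (intro bexI[of _ i]) auto
  qed simp
  ultimately show ?thesis
    using pos by (simp add: strict_subeigenvector_def mem_subeigencone_iff positive_vec_def m
        less_eq_vec_def less_imp_le)
qed

lemma positive_log_convex_comb_strict_subeigenvector:
  fixes A :: "real ^ 'n ^ 'n"
  assumes A: "nonneg_mat A" and m: "max_cycle_mean A = 1" and irr: "irreducible_mat A"
    and x: "positive_log_convex_comb (\<lambda>j. column j (kleene_star A)) x"
  shows "strict_subeigenvector A x"
proof -
  let ?S = "kleene_star A"
  have le1: "max_cycle_mean A \<le> 1"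
    using m by simp
  note S_pos = kleene_star_pos[OF A le1 irr]
  obtain c where c: "\<And>k. 0 < c k" "(\<Sum>k\<in>UNIV. c k) = 1"
    and xc: "x = (\<chi> i. \<Prod>k\<in>UNIV. (column k ?S $ i) powr c k)"
    using x by (auto simp: positive_log_convex_comb_def)
  have xi: "x $ i = (\<Prod>k\<in>UNIV. ?S $ i $ k powr c k)" for i
    by (simp add: xc column_def)
  have pos: "0 < x $ i" for i
    unfolding xi using S_pos by (intro prod_pos) (metis powr_gt_zero less_irrefl)
  have Ax: "A $ i $ j * x $ j = (\<Prod>k\<in>UNIV. (A $ i $ j * ?S $ j $ k) powr c k)"
    if "0 < A $ i $ j" for i j
  proof -
    \<comment> \<open>The exponents sum to 1, so the factor \<open>A $ i $ j\<close> can be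
      distributed over the product and the columns compared one by one.\<close>
    have "A $ i $ j = (\<Prod>k\<in>UNIV. A $ i $ j powr c k)"
      using that c(2) powr_sum[of "A $ i $ j" c UNIV] by simp
    then have "A $ i $ j * x $ j = (\<Prod>k\<in>UNIV. A $ i $ j powr c k) * (\<Prod>k\<in>UNIV. ?S $ j $ k powr c k)"
      by (simp add: xi)
    then show ?thesis
      using that S_pos by (simp add: powr_mult less_imp_le flip: prod.distrib)
  qed
  have factor: "(A $ i $ j * ?S $ j $ k) powr c k \<le> ?S $ i $ k powr c k" for i j k
    using A S_pos[of j k] c(1)[of k] mult_kleene_star_le[OF A le1]
    by (intro powr_mono2) (auto simp: nonneg_mat_def less_imp_le)
  have zero: "A $ i $ j * x $ j < x $ i" if "\<not> 0 < A $ i $ j" for i j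
    using that A pos[of i] by (metis nonneg_mat_def less_eq_real_def mult_zero_left)
  have "A $ i $ j * x $ j \<le> x $ i" for i j
  proof (cases "0 < A $ i $ j")
    case True
    show ?thesis
      unfolding Ax[OF True] xi[of i] by (intro prod_mono conjI factor powr_ge_zero)
  qed (simp add: zero less_imp_le)
  moreover have "A $ i $ j * x $ j < x $ i" if "(i, j) \<notin> critical_edges A" for i j
  proof (cases "0 < A $ i $ j")
    case True
    let ?f = "\<lambda>k. (A $ i $ j * ?S $ j $ k) powr c k" and ?g = "\<lambda>k. ?S $ i $ k powr c k"
    have "A $ i $ j * ?S $ j $ i < ?S $ i $ i"
      using mult_kleene_star_less[OF A m that] kleene_star_diagonal_ge[OF A le1, of i] by linarith
    then have less: "?f i < ?g i"
      using True S_pos[of j i] c(1)[of i] by (intro powr_less_mono2) auto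
    \<comment> \<open>One strict factor suffices because all factors on the right are positive,
      which is where irreducibility enters.\<close>
    have "prod ?f UNIV < prod ?g UNIV"
      using less factor S_pos[of i]
      by (intro prod_mono_strict[of i]) (auto simp: powr_gt_zero less_imp_neq[symmetric])
    then show ?thesis
      unfolding Ax[OF True] xi[of i] .
  qed (simp add: zero)
  ultimately show ?thesis
    using pos by (simp add: strict_subeigenvector_def mem_subeigencone_iff positive_vec_def m
        less_eq_vec_def less_imp_le)
qed

section \<open>Existence of a strict subeigenvector and conclusion\<close>

text \<open>Division by the maximal cycle mean makes the matrix definite without changing its
  critical edges, and its strict subeigenvectors are also strict for \<open>A\<close>.\<close>

lemma strict_subeigenvector_exists:
  fixes A :: "real ^ 'n ^ 'n"
  assumes A: "nonneg_mat A" and m: "0 < max_cycle_mean A"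
  obtains z where "strict_subeigenvector A z"
proof -
  let ?B = "inverse (max_cycle_mean A) *\<^sub>R A"
  let ?z = "\<Sum>k\<in>UNIV. 1 *\<^sub>R column k (kleene_star ?B)"
  have B: "nonneg_mat ?B"
    using A m by (simp add: nonneg_mat_def)
  have max: "max_cycle_mean ?B = 1" and crit: "critical_edges ?B = critical_edges A"
    using A m by (simp_all add: max_cycle_mean_scaleR critical_edges_scaleR)
  have "positive_linear_comb (\<lambda>j. column j (kleene_star ?B)) ?z"
    unfolding positive_linear_comb_def by (intro exI[of _ "\<lambda>_. 1"]) simp
  then have z: "strict_subeigenvector ?B ?z"
    by (rule positive_linear_comb_strict_subeigenvector[OF B max])
  have scale: "inverse (max_cycle_mean A) * s \<le> t \<longleftrightarrow> s \<le> max_cycle_mean A * t"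
      "inverse (max_cycle_mean A) * s < t \<longleftrightarrow> s < max_cycle_mean A * t" for s t
    using m by (auto simp: field_simps)
  have "strict_subeigenvector A y" if "strict_subeigenvector ?B y" for y
    using that
    by (simp add: strict_subeigenvector_def mem_subeigencone_iff max crit mult.assoc scale)
  then show ?thesis
    using z that by blast
qed

theorem theorem3p7:
  fixes A :: "real ^ 'n ^ 'n"
  assumes "nonneg_mat A"
    and "0 < max_cycle_mean A"
  shows "span (subeigencone A) = critical_subspace A \<and>
    (\<forall>x. 0 \<le> x \<longrightarrow>
       (x \<in> rel_interior (subeigencone A) \<longleftrightarrow>
        positive_vec x \<and> strictly_visualized (diag_scaling x A))) \<and>
    ((\<exists>x \<in> rel_interior (subeigencone A). eigenvector A x) \<longleftrightarrow>
       subeigencone A = eigencone A) \<and>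
    (definite_mat A \<longrightarrow>
       (\<forall>x. positive_linear_comb (\<lambda>j. column j (kleene_star A)) x \<longrightarrow>
          x \<in> rel_interior (subeigencone A) \<and> strictly_visualized (diag_scaling x A)) \<and>
       (irreducible_mat A \<longrightarrow>
          (\<forall>x. positive_log_convex_comb (\<lambda>j. column j (kleene_star A)) x \<longrightarrow>
             x \<in> rel_interior (subeigencone A) \<and> strictly_visualized (diag_scaling x A))))"
proof -
  obtain z where z: "strict_subeigenvector A z"
    using strict_subeigenvector_exists[OF assms] .
  note ri = rel_interior_subeigencone[OF assms z]
  note visual = strict_subeigenvector_iff_strictly_visualized[OF assms]
  \<comment> \<open>Rewriting with \<open>ri\<close> and \<open>visual\<close> turns membership in
    the relative interior into positivity together with strict visualization, so the clauses on
    combinations need only strictness.\<close>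
  show ?thesis
    using span_subeigencone[OF assms z] eigencone_eq_subeigencone_iff[OF assms z]
      positive_linear_comb_strict_subeigenvector[OF assms(1)]
      positive_log_convex_comb_strict_subeigenvector[OF assms(1)]
    by (auto simp: definite_mat_def ri visual)
qed

end
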